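(* Let $G$ be a graph with $n$ vertices and $H$ a graph with $m$ vertices, where $4\leq n\leq m\leq 2n$. Then $D'(G+H)\leq 2$.
   Context: The join $G+H$ of graphs on disjoint vertex sets has as edges all edges of $G$, all edges of $H$, and all pairs with one end in $V(G)$ and the other in $V(H)$. The distinguishing index $D'(X)$ is the least $d$ such that $X$ has an edge colouring with $d$ colours preserved by no non-identity automorphism of $X$. *)

theory Defs
  imports "HOL-Combinatorics.Permutations" "HOL-Library.Extended_Nat"
begin

record 'a ugraph =
  verts :: "'a set"
  edges :: "'a set set"

definition simple_graph :: "'a ugraph \<Rightarrow> bool" where
  "simple_graph G \<longleftrightarrow>
     finite (verts G) \<and> (\<forall>e\<in>edges G. e \<subseteq> verts G \<and> card e = 2)"

definition graph_join :: "'a ugraph \<Rightarrow> 'a ugraph \<Rightarrow> 'a ugraph" where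
  "graph_join G H =
     \<lparr>verts = verts G \<union> verts H,
      edges = edges G \<union> edges H \<union> {{u, v} |u v. u \<in> verts G \<and> v \<in> verts H}\<rparr>"

(* An automorphism is extended by the identity outside the vertex set (this is part of
   "permutes"), so that the non-identity automorphisms are exactly those different from id. *)
definition automorphism :: "'a ugraph \<Rightarrow> ('a \<Rightarrow> 'a) \<Rightarrow> bool" where
  "automorphism X f \<longleftrightarrow>
     f permutes verts X \<and>
     (\<forall>u\<in>verts X. \<forall>v\<in>verts X. {f u, f v} \<in> edges X \<longleftrightarrow> {u, v} \<in> edges X)"

(* Colourings need not be proper, nor use every colour. Only the values on edges matter. *)
definition edge_colouring :: "'a ugraph \<Rightarrow> nat \<Rightarrow> ('a set \<Rightarrow> nat) \<Rightarrow> bool" where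
  "edge_colouring X d c \<longleftrightarrow> (\<forall>e\<in>edges X. c e < d)"

definition preserves_colouring :: "'a ugraph \<Rightarrow> ('a set \<Rightarrow> nat) \<Rightarrow> ('a \<Rightarrow> 'a) \<Rightarrow> bool" where
  "preserves_colouring X c f \<longleftrightarrow> (\<forall>e\<in>edges X. c (f ` e) = c e)"

definition distinguishing :: "'a ugraph \<Rightarrow> ('a set \<Rightarrow> nat) \<Rightarrow> bool" where
  "distinguishing X c \<longleftrightarrow>
     \<not> (\<exists>f. automorphism X f \<and> f \<noteq> id \<and> preserves_colouring X c f)"

(* Some graphs, such as K_2, have no distinguishing edge colouring at all. The infimum is
   taken in enat, so it is \<infinity> for them, and otherwise it is the least such d. *)
definition distinguishing_index :: "'a ugraph \<Rightarrow> enat" where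
  "distinguishing_index X =
     (INF d \<in> {d. \<exists>c. edge_colouring X d c \<and> distinguishing X c}. enat d)"

end

theory Submission
  imports Defs
begin

text \<open>
  It suffices to find a spanning subgraph of the join without non-trivial automorphisms: colour its
  edges with one colour and all others with the second one. Such a subgraph exists already in the
  complete bipartite graph between the two vertex sets. Take the path \<open>0, 1, \<dots>, 2n-1\<close>, alternating
  between the sides and ending in \<open>G\<close>, with the chords \<open>{0,5}\<close> and \<open>{1,4}\<close>. An automorphism
  fixes its only leaf \<open>2n-1\<close>, hence the path down to \<open>5\<close>, and then everything, because \<open>0\<close> and
  \<open>4\<close> have different degrees. The remaining \<open>m - n \<le> n\<close> vertices of \<open>H\<close> are hung as pendants on
  distinct vertices of \<open>G\<close>, the first of them on the leaf \<open>2n-1\<close>; if there are any, they are exactly the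
  leaves, so an automorphism preserves the path.
\<close>

section \<open>Reduction to an edge set without symmetry\<close>

text \<open>With colour 1 on \<open>S\<close> and 0 elsewhere, an automorphism that preserves
  colours preserves membership in \<open>S\<close>: on edges by the colours, on other pairs because
  \<open>S\<close> contains edges only.\<close>

lemma distinguishing_index_le_2:
  assumes S: "S \<subseteq> edges X"
    and asym: "\<And>f. \<lbrakk>f permutes verts X;
      \<And>u v. \<lbrakk>u \<in> verts X; v \<in> verts X\<rbrakk> \<Longrightarrow> {f u, f v} \<in> S \<longleftrightarrow> {u, v} \<in> S\<rbrakk> \<Longrightarrow> f = id"
  shows "distinguishing_index X \<le> 2"
proof -
  define c where "c e = (if e \<in> S then 1 else 0 :: nat)" for e
  have "distinguishing X c"
    unfolding distinguishing_def
  proof (rule notI, elim exE conjE)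
    fix f
    assume f: "automorphism X f" "f \<noteq> id" "preserves_colouring X c f"
    have perm: "f permutes verts X"
      using f(1) by (simp add: automorphism_def)
    have "f = id"
    proof (rule asym[OF perm])
      fix u v
      assume uv: "u \<in> verts X" "v \<in> verts X"
      have E: "{f u, f v} \<in> edges X \<longleftrightarrow> {u, v} \<in> edges X"
        using f(1) uv by (simp add: automorphism_def)
      have "{u, v} \<in> edges X \<Longrightarrow> c {f u, f v} = c {u, v}"
        using f(3) by (force simp: preserves_colouring_def)
      then show "{f u, f v} \<in> S \<longleftrightarrow> {u, v} \<in> S"
        using E S by (auto simp: c_def split: if_splits)
    qed
    then show False using f(2) by contradiction
  qed
  moreover have "edge_colouring X 2 c"
    by (simp add: edge_colouring_def c_def)
  ultimately have "distinguishing_index X \<le> enat 2"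
    unfolding distinguishing_index_def by (intro INF_lower) blast
  then show ?thesis by (simp add: numeral_eq_enat)
qed

section \<open>Rigidity of the path with two chords\<close>

text \<open>The path is left infinite here; restricting the vertices to numbers below
  \<open>2 * n\<close> is what turns \<open>2 * n - 1\<close> into a leaf.\<close>

definition core_adj :: "nat \<Rightarrow> nat \<Rightarrow> bool" where
  "core_adj i j \<longleftrightarrow> j = Suc i \<or> i = Suc j \<or> {i, j} = {0, 5} \<or> {i, j} = {1, 4}"

lemma core_adj_commute: "core_adj i j \<longleftrightarrow> core_adj j i"
  by (auto simp: core_adj_def doubleton_eq_iff)

lemma core_adj_parity: "core_adj i j \<Longrightarrow> odd i \<longleftrightarrow> even j"
  by (auto simp: core_adj_def doubleton_eq_iff)

lemma core_nbrs:
  "core_adj 0 j \<longleftrightarrow> j = 1 \<or> j = 5"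
  "core_adj 1 j \<longleftrightarrow> j = 0 \<or> j = 2 \<or> j = 4"
  "core_adj 4 j \<longleftrightarrow> j = 1 \<or> j = 3 \<or> j = 5"
  "core_adj 5 j \<longleftrightarrow> j = 0 \<or> j = 4 \<or> j = 6"
  "6 \<le> i \<Longrightarrow> core_adj i j \<longleftrightarrow> j = i - 1 \<or> j = i + 1"
  by (auto simp: core_adj_def doubleton_eq_iff)

lemma core_two_nbrs:
  assumes "4 \<le> n" "i < 2 * n - 1"
  obtains a b where "a < 2 * n" "b < 2 * n" "a \<noteq> b" "core_adj i a" "core_adj i b"
proof (cases i)
  case 0
  then show ?thesis using that[of 1 5] assms by (simp add: core_nbrs)
next
  case (Suc k)
  then show ?thesis using that[of k "i + 1"] assms by (simp add: core_adj_def)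
qed

lemma core_rigid:
  assumes n: "4 \<le> n"
    and g: "bij_betw g {..<2 * n} {..<2 * n}"
    and adj: "\<And>i j. \<lbrakk>i < 2 * n; j < 2 * n\<rbrakk> \<Longrightarrow> core_adj (g i) (g j) \<longleftrightarrow> core_adj i j"
    and i: "i < 2 * n"
  shows "g i = i"
proof -
  have inj: "g a = g b \<longleftrightarrow> a = b" if "a < 2 * n" "b < 2 * n" for a b
    using g that by (auto simp: bij_betw_def inj_on_def)
  have lt: "g a < 2 * n" if "a < 2 * n" for a
    using g that by (auto simp: bij_betw_def)
  have surj: "\<exists>a'<2 * n. g a' = a" if "a < 2 * n" for a
    using bij_betw_imp_surj_on[OF g] that by (metis imageE lessThan_iff)
  \<comment> \<open>Any other image has two neighbours, whose preimages would be two distinct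
    neighbours of \<open>2 * n - 1\<close>.\<close>
  have last: "g (2 * n - 1) = 2 * n - 1"
  proof (rule ccontr)
    assume "g (2 * n - 1) \<noteq> 2 * n - 1"
    with lt[of "2 * n - 1"] n have "g (2 * n - 1) < 2 * n - 1" by linarith
    from core_two_nbrs[OF n this] obtain a b where ab: "a < 2 * n" "b < 2 * n" "a \<noteq> b"
      "core_adj (g (2 * n - 1)) a" "core_adj (g (2 * n - 1)) b" by metis
    have only: "a' = 2 * n - 2" if "a' < 2 * n" "core_adj (g (2 * n - 1)) (g a')" for a'
    proof -
      have "core_adj (2 * n - 1) a'" using that adj n by auto
      then show ?thesis using that(1) n by (auto simp: core_nbrs)
    qed
    from surj[OF ab(1)] surj[OF ab(2)] show False
      using ab only by metis
  qed
  \<comment> \<open>Here \<open>j\<close> counts backwards from the leaf, and its bound stops the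
    descent at 5. Each step uses that vertices from 6 on meet no chord.\<close>
  have tail: "g (2 * n - Suc j) = 2 * n - Suc j" if "j \<le> 2 * n - 6" for j
    using that
  proof (induction j rule: less_induct)
    case (less j)
    show ?case
    proof (cases j)
      case 0
      then show ?thesis using last by simp
    next
      case (Suc j')
      define k where "k = 2 * n - Suc j'"
      have k: "6 \<le> k" "k < 2 * n" "2 * n - Suc j = k - 1"
        using less.prems Suc n by (auto simp: k_def)
      have gk: "g k = k" using less.IH[of j'] less.prems Suc by (simp add: k_def)
      have "core_adj (g k) (g (k - 1))"
        using k by (subst adj) (auto simp: core_nbrs)
      then have *: "g (k - 1) = k - 1 \<or> g (k - 1) = k + 1"
        using gk k by (simp add: core_nbrs)
      have "g (k - 1) \<noteq> k + 1"
      proof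
        \<comment> \<open>Then \<open>k + 1\<close> is a core vertex, so \<open>j'\<close> is
          positive and \<open>j' - 1\<close> does not truncate; the induction hypothesis fixes
          \<open>k + 1\<close>, against injectivity.\<close>
        assume eq: "g (k - 1) = k + 1"
        then have lt_k: "k + 1 < 2 * n" using lt[of "k - 1"] k by simp
        then have "g (2 * n - Suc (j' - 1)) = 2 * n - Suc (j' - 1)"
          using less.IH[of "j' - 1"] less.prems Suc by simp
        moreover have "2 * n - Suc (j' - 1) = k + 1"
          using lt_k k(1) by (simp add: k_def)
        ultimately show False using eq inj[of "k - 1" "k + 1"] lt_k by simp
      qed
      then show ?thesis using * k by simp
    qed
  qed
  have ge5: "g k = k" if "5 \<le> k" "k < 2 * n" for k
    using tail[of "2 * n - Suc k"] that by simp
  \<comment> \<open>From \<open>4 \<le> n\<close>, everything up to 7 is in the core, in particular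
    6, the fixed path neighbour of 5.\<close>
  have lt8: "a < 2 * n" if "a < 8" for a using that n by linarith
  have nb: "core_adj (g a) (g b)" if "core_adj a b" "a < 8" "b < 8" for a b
    using adj[of a b] that lt8 by simp
  have g5: "g 5 = 5" "g 6 = 6" using ge5 lt8 by simp_all
  have inj8: "g a = g b \<longleftrightarrow> a = b" if "a < 8" "b < 8" for a b
    using inj that lt8 by simp
  have g4: "g 4 = 0 \<or> g 4 = 4"
    using nb[of 5 4] g5 inj8[of 4 6] by (auto simp: core_nbrs)
  \<comment> \<open>Otherwise 1 and 3 would both go to 1, as the other neighbour 5 of 0 is the image
    of itself.\<close>
  have "g 4 \<noteq> 0"
  proof
    assume "g 4 = 0"
    then have "g 1 = 1 \<or> g 1 = 5" "g 3 = 1 \<or> g 3 = 5"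
      using nb[of 4 1] nb[of 4 3] by (auto simp: core_nbrs)
    then show False
      using g5 inj8[of 1 3] inj8[of 1 5] inj8[of 3 5] by auto
  qed
  with g4 have g4: "g 4 = 4" by simp
  \<comment> \<open>In the order 0, 1, 3, 2, each vertex is the last unfixed neighbour of a vertex
    already fixed.\<close>
  have g0: "g 0 = 0"
    using nb[of 5 0] g4 g5 inj8[of 0 4] inj8[of 0 6] by (auto simp: core_nbrs)
  have g1: "g 1 = 1"
    using nb[of 0 1] g0 g5 inj8[of 1 5] by (auto simp: core_nbrs)
  have g3: "g 3 = 3"
    using nb[of 4 3] g4 g1 g5 inj8[of 3 1] inj8[of 3 5] by (auto simp: core_nbrs)
  have g2: "g 2 = 2"
    using nb[of 1 2] g1 g0 g4 inj8[of 2 0] inj8[of 2 4] by (auto simp: core_nbrs simp del: One_nat_def)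
  have "i = 0 \<or> i = 1 \<or> i = 2 \<or> i = 3 \<or> i = 4 \<or> 5 \<le> i" by linarith
  then show ?thesis using g0 g1 g2 g3 g4 ge5 i by auto
qed

section \<open>The core with its pendants\<close>

definition red :: "nat \<Rightarrow> nat \<Rightarrow> nat \<Rightarrow> bool" where
  "red n i j \<longleftrightarrow> i < 2 * n \<and> j < 2 * n \<and> core_adj i j \<or>
     2 * n \<le> j \<and> i + 2 * j + 1 = 6 * n \<or> 2 * n \<le> i \<and> j + 2 * i + 1 = 6 * n"
  \<comment> \<open>The pendant \<open>2n+k\<close> hangs on \<open>2n-1-2k\<close>.\<close>

lemma red_commute: "red n i j \<longleftrightarrow> red n j i"
  by (auto simp: red_def core_adj_commute)

text \<open>The odd numbers below \<open>2 * n\<close> will number \<open>G\<close>. Path edges and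
  chords change parity, and pendants hang on such odd numbers, so every red pair crosses the
  join.\<close>

lemma red_sides:
  assumes "red n i j"
  shows "odd i \<and> i < 2 * n \<longleftrightarrow> \<not> (odd j \<and> j < 2 * n)"
proof -
  have "odd i \<and> i < 2 * n" if "i + 2 * j + 1 = 6 * n" "2 * n \<le> j" for i j
    using that by presburger
  then show ?thesis
    using assms core_adj_parity unfolding red_def by (metis leD)
qed

lemma red_rigid:
  assumes n: "4 \<le> n" and m: "n \<le> m" "m \<le> 2 * n"
    and g: "bij_betw g {..<n + m} {..<n + m}"
    and adj: "\<And>i j. \<lbrakk>i < n + m; j < n + m\<rbrakk> \<Longrightarrow> red n (g i) (g j) \<longleftrightarrow> red n i j"
    and i: "i < n + m"
  shows "g i = i"
proof -
  have lt: "g a < n + m" if "a < n + m" for a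
    using g that by (auto simp: bij_betw_def)
  have core: "g a < 2 * n \<longleftrightarrow> a < 2 * n" if a: "a < n + m" for a
  proof (cases "m = n")
    case True
    then show ?thesis using a lt[OF a] by simp
  next
    case False
    \<comment> \<open>Having at most one neighbour is stated by quantifiers over the vertex range,
      so that reindexing along \<open>g\<close> shows it invariant.\<close>
    define leaf where
      "leaf i \<longleftrightarrow> (\<forall>x<n + m. \<forall>y<n + m. red n i x \<longrightarrow> red n i y \<longrightarrow> x = y)" for i
    have leaf_iff: "leaf i \<longleftrightarrow> 2 * n \<le> i" if "i < n + m" for i
    proof
      show "leaf i" if "2 * n \<le> i"
        using that by (auto simp: leaf_def red_def)
      show "2 * n \<le> i" if leaf: "leaf i"
      proof (rule ccontr)
        assume "\<not> 2 * n \<le> i"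
        then consider "i < 2 * n - 1" | "i = 2 * n - 1" by linarith
        then show False
        proof cases
          case 1
          with core_two_nbrs[OF n] obtain a b where "a < 2 * n" "b < 2 * n" "a \<noteq> b"
            "core_adj i a" "core_adj i b" by metis
          then show False using leaf 1 m by (auto simp: leaf_def red_def)
        next
          case 2
          \<comment> \<open>Since \<open>m \<noteq> n\<close>, the pendant \<open>2 * n\<close> is
            in the range and gives the end of the path a second neighbour.\<close>
          then have "red n i (2 * n - 2)" "red n i (2 * n)"
            using n by (auto simp: red_def core_nbrs)
          then have "2 * n - 2 = 2 * n"
            using leaf m False unfolding leaf_def by auto
          then show False using n by simp
        qed
      qed
    qed
    have all_g: "(\<forall>x<n + m. P (g x)) \<longleftrightarrow> (\<forall>x<n + m. P x)" for P
      using bij_betw_imp_surj_on[OF g] by (metis imageE lessThan_iff lt)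
    have "leaf (g a) \<longleftrightarrow> (\<forall>x<n + m. \<forall>y<n + m.
        red n (g a) (g x) \<longrightarrow> red n (g a) (g y) \<longrightarrow> g x = g y)"
      unfolding leaf_def by (subst all_g[symmetric], subst (2) all_g[symmetric]) (rule refl)
    also have "\<dots> \<longleftrightarrow> leaf a"
      using a by (simp add: leaf_def adj inj_on_eq_iff[OF bij_betw_imp_inj_on[OF g]])
    finally have "leaf (g a) \<longleftrightarrow> leaf a" .
    then show ?thesis using leaf_iff a lt[OF a] by auto
  qed
  have inj: "inj_on g {..<n + m}" using g by (rule bij_betw_imp_inj_on)
  have "g ` {..<2 * n} = {..<2 * n}"
    using m core inj by (intro endo_inj_surj) (auto intro: inj_on_subset)
  then have bij: "bij_betw g {..<2 * n} {..<2 * n}"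
    using m inj by (auto simp: bij_betw_def intro: inj_on_subset)
  have fixed: "g a = a" if "a < 2 * n" for a
  proof (rule core_rigid[OF n bij _ that])
    fix x y
    assume "x < 2 * n" "y < 2 * n"
    then show "core_adj (g x) (g y) \<longleftrightarrow> core_adj x y"
      using adj[of x y] core[of x] core[of y] m by (simp add: red_def)
  qed
  show ?thesis
  proof (cases "i < 2 * n")
    case True
    then show ?thesis by (rule fixed)
  next
    case False
    \<comment> \<open>The vertex carrying the pendant \<open>i\<close>; \<open>i < 3 * n\<close>
      prevents truncation. As \<open>a\<close> is fixed and carries no other pendant, the pendant
      \<open>g i\<close> must be \<open>i\<close>.\<close>
    define a where "a = 6 * n - 1 - 2 * i"
    have a: "a + 2 * i + 1 = 6 * n" "a < 2 * n"
      using False i m by (auto simp: a_def)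
    then have "red n (g a) (g i)"
      using adj[of a i] False i m by (simp add: red_def)
    then show ?thesis
      using fixed[OF a(2)] a core[OF i] False by (auto simp: red_def)
  qed
qed

section \<open>Transfer to the join\<close>

text \<open>There are \<open>n\<close> odd numbers below \<open>2 * n\<close>, which leaves
  \<open>m\<close> numbers for \<open>B\<close>: the even path vertices and the pendants.\<close>

lemma ex_vertex_numbering:
  assumes "finite A" "finite B" "A \<inter> B = {}" "card A = n" "card B = m" "n \<le> m"
  obtains \<phi> where "bij_betw \<phi> {..<n + m} (A \<union> B)"
    "\<And>i. i < n + m \<Longrightarrow> \<phi> i \<in> A \<longleftrightarrow> odd i \<and> i < 2 * n"
proof -
  define Q where "Q = {i. odd i \<and> i < 2 * n}"
  have "Q = (\<lambda>k. 2 * k + 1) ` {..<n}"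
    by (auto simp: Q_def elim!: oddE)
  then have cO: "card Q = n" by (simp add: card_image inj_on_def)
  have OS: "Q \<subseteq> {..<n + m}" using assms(6) by (auto simp: Q_def)
  then have fO: "finite Q" by (rule finite_subset) simp
  have cR: "card ({..<n + m} - Q) = m" using OS fO cO by (simp add: card_Diff_subset)
  obtain f where f: "bij_betw f Q A"
    using finite_same_card_bij[OF fO assms(1)] cO assms(4) by auto
  obtain h where h: "bij_betw h ({..<n + m} - Q) B"
    using finite_same_card_bij[of "{..<n + m} - Q" B] cR assms(2,5) by auto
  define \<phi> where "\<phi> i = (if i \<in> Q then f i else h i)" for i
  have 1: "bij_betw \<phi> Q A" using f by (simp add: \<phi>_def cong: bij_betw_cong)
  have 2: "bij_betw \<phi> ({..<n + m} - Q) B"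
    using h by (subst bij_betw_cong[of _ _ h]) (auto simp: \<phi>_def)
  have "bij_betw \<phi> {..<n + m} (A \<union> B)"
    using bij_betw_combine[OF 1 2 assms(3)] OS by (simp add: Un_absorb1)
  moreover have "\<phi> i \<in> A \<longleftrightarrow> odd i \<and> i < 2 * n" if "i < n + m" for i
  proof (cases "i \<in> Q")
    case True
    then show ?thesis using bij_betwE[OF 1] by (auto simp: Q_def)
  next
    case False
    then show ?thesis using bij_betwE[OF 2] that assms(3) by (auto simp: Q_def)
  qed
  ultimately show ?thesis by (rule that)
qed

theorem theorem3p4:
  fixes G H :: "'a ugraph" and n m :: nat
  assumes "simple_graph G" and "simple_graph H"
    and "verts G \<inter> verts H = {}"
    and "card (verts G) = n" and "card (verts H) = m"
    and "4 \<le> n" and "n \<le> m" and "m \<le> 2 * n"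
  shows "distinguishing_index (graph_join G H) \<le> 2"
proof -
  let ?X = "graph_join G H" and ?I = "{..<n + m}"
  have V: "verts ?X = verts G \<union> verts H" by (simp add: graph_join_def)
  obtain \<phi> where \<phi>: "bij_betw \<phi> ?I (verts ?X)"
    and \<phi>G: "\<And>i. i < n + m \<Longrightarrow> \<phi> i \<in> verts G \<longleftrightarrow> odd i \<and> i < 2 * n"
    using ex_vertex_numbering[of "verts G" "verts H" n m] assms
    unfolding V simple_graph_def by metis
  define S where "S = {{\<phi> i, \<phi> j} |i j. i < n + m \<and> j < n + m \<and> red n i j}"
  have \<phi>_inj: "\<phi> i = \<phi> j \<longleftrightarrow> i = j" if "i < n + m" "j < n + m" for i j
    using \<phi> that by (auto simp: bij_betw_def inj_on_def)
  have S_iff: "{\<phi> i, \<phi> j} \<in> S \<longleftrightarrow> red n i j" if "i < n + m" "j < n + m" for i j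
    using that red_commute by (auto simp: S_def doubleton_eq_iff \<phi>_inj)
  show ?thesis
  proof (rule distinguishing_index_le_2)
    show "S \<subseteq> edges ?X"
    proof
      fix e
      assume "e \<in> S"
      then obtain i j where e: "e = {\<phi> i, \<phi> j}" "i < n + m" "j < n + m" "red n i j"
        by (auto simp: S_def)
      have "\<phi> i \<in> verts G \<longleftrightarrow> \<phi> j \<notin> verts G"
        using red_sides[OF e(4)] e(2,3) \<phi>G by simp
      moreover have "\<phi> i \<in> verts G \<union> verts H" "\<phi> j \<in> verts G \<union> verts H"
        using bij_betwE[OF \<phi>] e(2,3) V by auto
      ultimately show "e \<in> edges ?X"
        unfolding e(1) graph_join_def by (auto simp: insert_commute)
    qed
    fix f
    assume f: "f permutes verts ?X"
      and adj: "\<And>u v. \<lbrakk>u \<in> verts ?X; v \<in> verts ?X\<rbrakk> \<Longrightarrow> {f u, f v} \<in> S \<longleftrightarrow> {u, v} \<in> S"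
    \<comment> \<open>Conjugation by the numbering turns \<open>f\<close> into a permutation of
      numbers, to which \<open>red_rigid\<close> applies.\<close>
    define g where "g = inv_into ?I \<phi> \<circ> f \<circ> \<phi>"
    have g: "bij_betw g ?I ?I"
      unfolding g_def
      using \<phi> permutes_imp_bij[OF f] bij_betw_inv_into[OF \<phi>] by (metis bij_betw_trans comp_assoc)
    have \<phi>V: "\<phi> i \<in> verts ?X" if "i < n + m" for i
      using bij_betwE[OF \<phi>] that by auto
    have \<phi>g: "\<phi> (g i) = f (\<phi> i)" if "i < n + m" for i
      using bij_betw_inv_into_right[OF \<phi>] \<phi>V[OF that] permutes_in_image[OF f] by (simp add: g_def)
    have glt: "g i < n + m" if "i < n + m" for i
      using bij_betwE[OF g] that by auto
    have gid: "g i = i" if i: "i < n + m" for i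
    proof (rule red_rigid[OF assms(6-8) g _ i])
      fix i j
      assume ij: "i < n + m" "j < n + m"
      have "red n (g i) (g j) \<longleftrightarrow> {f (\<phi> i), f (\<phi> j)} \<in> S"
        using S_iff[OF glt glt] ij \<phi>g by simp
      also have "\<dots> \<longleftrightarrow> red n i j"
        using adj[OF \<phi>V \<phi>V] S_iff ij by simp
      finally show "red n (g i) (g j) \<longleftrightarrow> red n i j" .
    qed
    show "f = id"
    proof
      fix v
      show "f v = id v"
      proof (cases "v \<in> verts ?X")
        case True
        then obtain i where "i < n + m" "v = \<phi> i"
          using bij_betw_imp_surj_on[OF \<phi>] by (metis imageE lessThan_iff)
        then show ?thesis using \<phi>g gid by simp
      next
        case False
        then show ?thesis using permutes_not_in[OF f] by simp
      qed
    qed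
  qed
qed

end
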